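(* Let $\mathfrak g$ be a Lie algebra. There is a one-to-one correspondence between flat torsion-free connections on $\mathfrak g$ and totally real integrable complex structures on semi-direct products $\mathfrak g\ltimes_\rho V$.
   Context: All Lie algebras are finite dimensional and real. For a vector space $V$ and a representation $\rho:\mathfrak g\to\mathrm{End}(V)$, the semi-direct product $\mathfrak g\ltimes_\rho V$ is the vector space $\mathfrak g\oplus V$ with Lie bracket $[x+u,y+v]=[x,y]+\rho(x)v-\rho(y)u$ for $x,y\in\mathfrak g$, $u,v\in V$. A connection on $\mathfrak g$ (corresponding to a left-invariant affine connection on a Lie group with Lie algebra $\mathfrak g$) is a linear map $\gamma:\mathfrak g\to\mathrm{End}(\mathfrak g)$; it is torsion-free if $[x,y]-\gamma(x)y+\gamma(y)x=0$ for all $x,y\in\mathfrak g$, and flat if $\gamma([x,y])-\gamma(x)\gamma(y)+\gamma(y)\gamma(x)=0$ for all $x,y\in\mathfrak g$. A complex structure on a Lie algebra $\mathfrak h$ is an endomorphism $J$ of $\mathfrak h$ with $J^2=-1$; it is integrable if $[x,y]-[Jx,Jy]+J([x,Jy]+[Jx,y])=0$ for all $x,y\in\mathfrak h$. A complex structure $J$ on $\mathfrak h=\mathfrak g\ltimes_\rho V$ is totally real if $\mathfrak h=\mathfrak g\oplus J\mathfrak g$ and $J\mathfrak g=V$. *)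

theory Defs
  imports "HOL-Analysis.Analysis"
begin

(* Vector spaces are types of class real_vector together with this predicate. The class
   euclidean_space is not used because it excludes the zero space. *)
definition finite_dim :: "'a::real_vector itself \<Rightarrow> bool" where
  "finite_dim _ \<longleftrightarrow> (\<exists>B :: 'a set. finite B \<and> span B = UNIV)"

definition lie_algebra :: "('g::real_vector \<Rightarrow> 'g \<Rightarrow> 'g) \<Rightarrow> bool" where
  "lie_algebra br \<longleftrightarrow> finite_dim TYPE('g) \<and> bilinear br \<and> (\<forall>x. br x x = 0) \<and>
     (\<forall>x y z. br x (br y z) + br y (br z x) + br z (br x y) = 0)"

(* A linear map from a vector space U to End(W) is represented by its uncurried form,
   a bilinear map from U and W to W; this is used for representations and connections. *)
definition lie_representation ::
    "('g::real_vector \<Rightarrow> 'g \<Rightarrow> 'g) \<Rightarrow> ('g \<Rightarrow> 'v::real_vector \<Rightarrow> 'v) \<Rightarrow> bool" where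
  "lie_representation br \<rho> \<longleftrightarrow> bilinear \<rho> \<and>
     (\<forall>x y v. \<rho> (br x y) v = \<rho> x (\<rho> y v) - \<rho> y (\<rho> x v))"

definition connection :: "('g::real_vector \<Rightarrow> 'g \<Rightarrow> 'g) \<Rightarrow> bool" where
  "connection \<gamma> \<longleftrightarrow> bilinear \<gamma>"

definition torsion_free ::
    "('g::real_vector \<Rightarrow> 'g \<Rightarrow> 'g) \<Rightarrow> ('g \<Rightarrow> 'g \<Rightarrow> 'g) \<Rightarrow> bool" where
  "torsion_free br \<gamma> \<longleftrightarrow> (\<forall>x y. br x y - \<gamma> x y + \<gamma> y x = 0)"

definition flat ::
    "('g::real_vector \<Rightarrow> 'g \<Rightarrow> 'g) \<Rightarrow> ('g \<Rightarrow> 'g \<Rightarrow> 'g) \<Rightarrow> bool" where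
  "flat br \<gamma> \<longleftrightarrow> (\<forall>x y z. \<gamma> (br x y) z - \<gamma> x (\<gamma> y z) + \<gamma> y (\<gamma> x z) = 0)"

definition flat_torsion_free_connections ::
    "('g::real_vector \<Rightarrow> 'g \<Rightarrow> 'g) \<Rightarrow> ('g \<Rightarrow> 'g \<Rightarrow> 'g) set" where
  "flat_torsion_free_connections br = {\<gamma>. connection \<gamma> \<and> flat br \<gamma> \<and> torsion_free br \<gamma>}"

definition semidirect_bracket ::
    "('g::real_vector \<Rightarrow> 'g \<Rightarrow> 'g) \<Rightarrow> ('g \<Rightarrow> 'v::real_vector \<Rightarrow> 'v) \<Rightarrow> 'g \<times> 'v \<Rightarrow> 'g \<times> 'v \<Rightarrow> 'g \<times> 'v" where
  "semidirect_bracket br \<rho> =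
     (\<lambda>(x, u) (y, v). (br x y, \<rho> x v - \<rho> y u))"

definition complex_structure :: "('h::real_vector \<Rightarrow> 'h) \<Rightarrow> bool" where
  "complex_structure J \<longleftrightarrow> linear J \<and> (\<forall>x. J (J x) = - x)"

definition integrable_structure ::
    "('h::real_vector \<Rightarrow> 'h \<Rightarrow> 'h) \<Rightarrow> ('h \<Rightarrow> 'h) \<Rightarrow> bool" where
  "integrable_structure br J \<longleftrightarrow>
     (\<forall>x y. br x y - br (J x) (J y) + J (br x (J y) + br (J x) y) = 0)"

abbreviation g_part :: "('g::real_vector \<times> 'v::real_vector) set" where
  "g_part \<equiv> UNIV \<times> {0}"

abbreviation V_part :: "('g::real_vector \<times> 'v::real_vector) set" where
  "V_part \<equiv> {0} \<times> UNIV"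

definition totally_real :: "('g::real_vector \<times> 'v::real_vector \<Rightarrow> 'g \<times> 'v) \<Rightarrow> bool" where
  "totally_real J \<longleftrightarrow>
     (\<forall>h. \<exists>a \<in> g_part. \<exists>b \<in> J ` g_part. h = a + b) \<and> g_part \<inter> J ` g_part = {0} \<and>
     J ` g_part = V_part"

type_synonym ('g, 'v) sd_structure = "('g \<Rightarrow> 'v \<Rightarrow> 'v) \<times> ('g \<times> 'v \<Rightarrow> 'g \<times> 'v)"

(* All pairs of a representation on V (given by the type 'v) and a totally real integrable
   complex structure on the corresponding semi-direct product. *)
definition totally_real_structures ::
    "('g::real_vector \<Rightarrow> 'g \<Rightarrow> 'g) \<Rightarrow> ('g, 'v::real_vector) sd_structure set" where
  "totally_real_structures br = {(\<rho>, J). lie_representation br \<rho> \<and> complex_structure J \<and>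
     totally_real J \<and> integrable_structure (semidirect_bracket br \<rho>) J}"

(* Equivalence of totally real structures over g: a holomorphic isomorphism of Lie algebras
   between the semi-direct products that is the identity on g and takes V to W. Without
   identifying equivalent structures the correspondence would not be one-to-one, as V and the
   isomorphism J : g -> V can be changed freely. *)
definition sd_equivalent ::
    "('g::real_vector \<Rightarrow> 'g \<Rightarrow> 'g) \<Rightarrow> ('g, 'v::real_vector) sd_structure \<Rightarrow>
      ('g, 'w::real_vector) sd_structure \<Rightarrow> bool" where
  "sd_equivalent br = (\<lambda>(\<rho>, J) (\<rho>', J'). \<exists>F :: 'g \<times> 'v \<Rightarrow> 'g \<times> 'w. linear F \<and> bij F \<and>
     (\<forall>p q. F (semidirect_bracket br \<rho> p q) = semidirect_bracket br \<rho>' (F p) (F q)) \<and>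
     (\<forall>p. F (J p) = J' (F p)) \<and> (\<forall>x. F (x, 0) = (x, 0)) \<and> F ` V_part = V_part)"

definition sd_equivalence ::
    "('g::real_vector \<Rightarrow> 'g \<Rightarrow> 'g) \<Rightarrow>
      (('g, 'v::real_vector) sd_structure \<times> ('g, 'v) sd_structure) set" where
  "sd_equivalence br = {(S, S'). S \<in> totally_real_structures br \<and>
     S' \<in> totally_real_structures br \<and> sd_equivalent br S S'}"

(* The structure of a connection: V is g itself, acted on by the connection, and J (x, y) = (-y, x). *)
definition structure_of_connection ::
    "('g::real_vector \<Rightarrow> 'g \<Rightarrow> 'g) \<Rightarrow> ('g, 'g) sd_structure" where
  "structure_of_connection \<gamma> = (\<gamma>, \<lambda>(x, y). (- y, x))"

(* The connection - J (rho x (J y)), i.e. - J [x, J y]. For totally real J the element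
   J (y, 0) lies in V and the image under J of an element of V lies in g. *)
definition connection_of_structure ::
    "('g::real_vector, 'v::real_vector) sd_structure \<Rightarrow> 'g \<Rightarrow> 'g \<Rightarrow> 'g" where
  "connection_of_structure = (\<lambda>(\<rho>, J) x y. - fst (J (0, \<rho> x (snd (J (y, 0))))))"

end

(* Up to the choice of an isomorphism phi : g -> V, a totally real J is (x, u) |-> (-phi^-1 u, phi x).
   Transporting rho along phi turns it into a connection on g; the representation property of rho
   is then flatness, and integrability of J, which only needs to be tested on pairs of elements
   of g, is vanishing torsion. *)

theory Submission
  imports Defs
begin

section \<open>Normal form of totally real complex structures\<close>

definition mutually_inverse_linear ::
    "('a::real_vector \<Rightarrow> 'b::real_vector) \<Rightarrow> ('b \<Rightarrow> 'a) \<Rightarrow> bool" where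
  "mutually_inverse_linear \<phi> \<psi> \<longleftrightarrow>
     linear \<phi> \<and> linear \<psi> \<and> (\<forall>x. \<psi> (\<phi> x) = x) \<and> (\<forall>u. \<phi> (\<psi> u) = u)"

text \<open>Such a map restricts to \<open>\<phi>\<close> on g and to \<open>- \<psi>\<close> on V;
  the sign is what makes its square -1 when \<open>\<psi>\<close> inverts
  \<open>\<phi>\<close>.\<close>

definition swap_structure ::
    "('a::real_vector \<Rightarrow> 'b::real_vector) \<Rightarrow> ('b \<Rightarrow> 'a) \<Rightarrow> 'a \<times> 'b \<Rightarrow> 'a \<times> 'b" where
  "swap_structure \<phi> \<psi> = (\<lambda>(x, u). (- \<psi> u, \<phi> x))"

text \<open>Only the second argument of \<open>\<gamma>\<close> and its values are moved to V along
  \<open>\<phi>\<close>; the argument in g stays fixed. This is the normal form to which all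
  structures are reduced below.\<close>

definition transported_structure ::
    "('g::real_vector \<Rightarrow> 'v::real_vector) \<Rightarrow> ('v \<Rightarrow> 'g) \<Rightarrow> ('g \<Rightarrow> 'g \<Rightarrow> 'g) \<Rightarrow> ('g, 'v) sd_structure" where
  "transported_structure \<phi> \<psi> \<gamma> = (\<lambda>x u. \<phi> (\<gamma> x (\<psi> u)), swap_structure \<phi> \<psi>)"

lemma mutually_inverse_linear_id: "mutually_inverse_linear (\<lambda>x. x) (\<lambda>x. x)"
  by (simp add: mutually_inverse_linear_def linear_ident)

lemma structure_of_connection_eq_transported:
  "structure_of_connection \<gamma> = transported_structure (\<lambda>x. x) (\<lambda>x. x) \<gamma>"
  by (simp add: structure_of_connection_def transported_structure_def swap_structure_def)

text \<open>The sign of \<open>- \<psi>\<close> cancels the sign in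
  \<open>connection_of_structure\<close>, and each \<open>\<phi>\<close> meets its inverse. Hence
  the connection can be read off whatever identification of g with V was chosen.\<close>

lemma connection_of_transported_structure:
  assumes "mutually_inverse_linear \<phi> \<psi>"
  shows "connection_of_structure (transported_structure \<phi> \<psi> \<gamma>) = \<gamma>"
  using assms
  by (auto simp: mutually_inverse_linear_def connection_of_structure_def
      transported_structure_def swap_structure_def linear_0)

lemma bilinear_transport:
  assumes "bilinear \<gamma>" "linear \<phi>" "linear \<psi>"
  shows "bilinear (\<lambda>x u. \<phi> (\<gamma> x (\<psi> u)))"
  using assms unfolding bilinear_def linear_iff by simp

lemma complex_structure_swap:
  assumes "mutually_inverse_linear \<phi> \<psi>"
  shows "complex_structure (swap_structure \<phi> \<psi>)"
proof -
  have "linear \<phi>" "linear \<psi>"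
    using assms by (auto simp: mutually_inverse_linear_def)
  then have "linear (swap_structure \<phi> \<psi>)"
    by (auto simp: linear_iff swap_structure_def)
  moreover have "swap_structure \<phi> \<psi> (swap_structure \<phi> \<psi> p) = - p" for p
    using assms by (cases p) (auto simp: mutually_inverse_linear_def swap_structure_def linear_neg)
  ultimately show ?thesis
    by (simp add: complex_structure_def)
qed

lemma totally_real_swap:
  assumes "mutually_inverse_linear \<phi> \<psi>"
  shows "totally_real (swap_structure \<phi> \<psi>)"
proof -
  have l: "\<psi> 0 = 0" and surj: "\<And>u. \<phi> (\<psi> u) = u"
    using assms by (auto simp: mutually_inverse_linear_def linear_0)
  have im: "swap_structure \<phi> \<psi> ` g_part = V_part"
  proof
    show "swap_structure \<phi> \<psi> ` g_part \<subseteq> V_part"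
      by (auto simp: swap_structure_def l)
    have "(0, u) = swap_structure \<phi> \<psi> (\<psi> u, 0)" for u
      by (simp add: swap_structure_def l surj)
    then show "V_part \<subseteq> swap_structure \<phi> \<psi> ` g_part"
      by blast
  qed
  have "\<exists>a \<in> g_part. \<exists>b \<in> V_part. h = a + b" for h :: "'a \<times> 'b"
    by (rule bexI[of _ "(fst h, 0)"], rule bexI[of _ "(0, snd h)"]) auto
  then show ?thesis
    unfolding totally_real_def im by (auto simp: zero_prod_def)
qed

text \<open>J maps g onto V, and J^2 = -1 then forces it to map V back into g. So J is off-diagonal,
  and its two blocks are inverse to each other up to sign.\<close>

lemma totally_real_imp_swap:
  assumes J: "complex_structure J" and tr: "totally_real J"
  obtains \<phi> \<psi> where "mutually_inverse_linear \<phi> \<psi>" "J = swap_structure \<phi> \<psi>"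
proof
  let ?\<phi> = "\<lambda>x. snd (J (x, 0))" and ?\<psi> = "\<lambda>u. - fst (J (0, u))"
  have lin: "linear J" and JJ: "\<And>p. J (J p) = - p"
    using J by (auto simp: complex_structure_def)
  have im: "J ` g_part = V_part"
    using tr by (simp add: totally_real_def)
  have g: "J (x, 0) = (0, ?\<phi> x)" for x
  proof -
    have "J (x, 0) \<in> V_part"
      unfolding im[symmetric] by (rule imageI) simp
    then show ?thesis
      by (cases "J (x, 0)") simp
  qed
  have v: "J (0, u) = (- ?\<psi> u, 0)" for u
  proof -
    have "(0, u) \<in> J ` g_part"
      using im by auto
    \<comment> \<open>Only the image of g under J is given. The image of V is reached by writing u
      as J of an element of g and applying J once more.\<close>
    then obtain x where "(0, u) = J (x, 0)"
      by auto
    then have "J (0, u) = (- x, 0)"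
      using JJ[of "(x, 0)"] by simp
    then show ?thesis
      by simp
  qed
  have \<psi>\<phi>: "?\<psi> (?\<phi> x) = x" for x
    using JJ[of "(x, 0)"] by (simp flip: g)
  have \<phi>\<psi>: "?\<phi> (?\<psi> u) = u" for u
  proof -
    \<comment> \<open>The vector \<open>(?\<psi> u, 0)\<close> is \<open>- J (0, u)\<close>, so this
      direction also follows from J^2 = -1.\<close>
    have "J (?\<psi> u, 0) = - J (J (0, u))"
      using linear_neg[OF lin, of "(- ?\<psi> u, 0)"] v[of u] by simp
    then show ?thesis
      by (simp add: JJ)
  qed
  have "linear ?\<phi>" "linear ?\<psi>"
    using linear_add[OF lin, of "(_, 0)" "(_, 0)"] linear_scale[OF lin, of _ "(_, 0)"]
      linear_add[OF lin, of "(0, _)" "(0, _)"] linear_scale[OF lin, of _ "(0, _)"]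
    by (auto simp: linear_iff)
  with \<psi>\<phi> \<phi>\<psi> show "mutually_inverse_linear ?\<phi> ?\<psi>"
    by (simp add: mutually_inverse_linear_def)
  have "J (x, u) = (- ?\<psi> u, ?\<phi> x)" for x u
    using linear_add[OF lin, of "(x, 0)" "(0, u)"] g[of x] v[of u]
    by (metis (no_types, lifting) add.left_neutral add.right_neutral add_Pair)
  then show "J = swap_structure ?\<phi> ?\<psi>"
    unfolding swap_structure_def by (intro ext) (metis (no_types, lifting) case_prod_conv surj_pair)
qed

section \<open>Integrability as vanishing torsion, representation property as flatness\<close>

lemma diff_add_eq_0_iff:
  fixes a b c :: "'a::ab_group_add"
  shows "a - b + c = 0 \<longleftrightarrow> a = b - c"
  using eq_iff_diff_eq_0[of a "b - c"] by (simp add: diff_diff_eq2 diff_add_eq)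

text \<open>For x, y in g the term [Jx, Jy] vanishes because V is abelian, and J takes [x, Jy] +
  [Jx, y] back to g. What remains is the torsion of \<open>\<rho>\<close> pulled back along
  \<open>\<phi>\<close>.\<close>

lemma integrable_swap_iff:
  assumes iso: "mutually_inverse_linear \<phi> \<psi>" and br: "bilinear br" and \<rho>: "bilinear \<rho>"
  shows "integrable_structure (semidirect_bracket br \<rho>) (swap_structure \<phi> \<psi>) \<longleftrightarrow>
    torsion_free br (\<lambda>x y. \<psi> (\<rho> x (\<phi> y)))"
proof
  have lin: "linear \<phi>" "linear \<psi>" and inv: "\<And>x. \<psi> (\<phi> x) = x" "\<And>u. \<phi> (\<psi> u) = u"
    using iso by (auto simp: mutually_inverse_linear_def)
  note zero = linear_0[OF lin(1)] linear_0[OF lin(2)] bilinear_lzero[OF br] bilinear_rzero[OF br]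
    bilinear_lzero[OF \<rho>] bilinear_rzero[OF \<rho>]
  note add_neg = linear_add[OF lin(1)] linear_add[OF lin(2)] linear_diff[OF lin(1)]
    linear_diff[OF lin(2)] linear_neg[OF lin(1)] linear_neg[OF lin(2)]
    bilinear_lneg[OF br] bilinear_rneg[OF br] bilinear_lneg[OF \<rho>] bilinear_rneg[OF \<rho>]
  show "torsion_free br (\<lambda>x y. \<psi> (\<rho> x (\<phi> y)))"
    if int: "integrable_structure (semidirect_bracket br \<rho>) (swap_structure \<phi> \<psi>)"
    unfolding torsion_free_def
  proof (intro allI)
    fix x y
    show "br x y - \<psi> (\<rho> x (\<phi> y)) + \<psi> (\<rho> y (\<phi> x)) = 0"
      using int[unfolded integrable_structure_def, rule_format, of "(x, 0)" "(y, 0)"]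
      by (simp add: semidirect_bracket_def swap_structure_def zero add_neg zero_prod_def algebra_simps)
  qed
  assume tf: "torsion_free br (\<lambda>x y. \<psi> (\<rho> x (\<phi> y)))"
  \<comment> \<open>Replacing every bracket of g by this commutator makes both components of the
    integrability expression cancel for arbitrary pairs, by direct computation.\<close>
  then have br_eq: "br x y = \<psi> (\<rho> x (\<phi> y)) - \<psi> (\<rho> y (\<phi> x))" for x y
    by (simp add: torsion_free_def diff_add_eq_0_iff)
  show "integrable_structure (semidirect_bracket br \<rho>) (swap_structure \<phi> \<psi>)"
    by (auto simp: integrable_structure_def semidirect_bracket_def swap_structure_def
        br_eq zero inv add_neg zero_prod_def)
qed

text \<open>The outer \<open>\<phi>\<close> is cancelled by injectivity, and \<open>\<psi> u\<close>
  runs through all of g by surjectivity.\<close>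

lemma lie_representation_transport_iff:
  assumes iso: "mutually_inverse_linear \<phi> \<psi>" and \<gamma>: "bilinear \<gamma>"
  shows "lie_representation br (\<lambda>x u. \<phi> (\<gamma> x (\<psi> u))) \<longleftrightarrow> flat br \<gamma>"
proof -
  have lin: "linear \<phi>" "linear \<psi>" and inv: "\<And>x. \<psi> (\<phi> x) = x" "\<And>u. \<phi> (\<psi> u) = u"
    using iso by (auto simp: mutually_inverse_linear_def)
  have inj: "\<phi> a = \<phi> b \<longleftrightarrow> a = b" for a b
    by (metis inv(1))
  have "lie_representation br (\<lambda>x u. \<phi> (\<gamma> x (\<psi> u))) \<longleftrightarrow>
    (\<forall>x y u. \<gamma> (br x y) (\<psi> u) = \<gamma> x (\<gamma> y (\<psi> u)) - \<gamma> y (\<gamma> x (\<psi> u)))"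
    by (simp add: lie_representation_def bilinear_transport[OF \<gamma> lin] inv inj flip: linear_diff[OF lin(1)])
  \<comment> \<open>Any z is \<open>\<psi> u\<close> with u = \<open>\<phi> z\<close>.\<close>
  also have "\<dots> \<longleftrightarrow> (\<forall>x y z. \<gamma> (br x y) z = \<gamma> x (\<gamma> y z) - \<gamma> y (\<gamma> x z))"
    by (metis inv(1))
  also have "\<dots> \<longleftrightarrow> flat br \<gamma>"
    by (simp add: flat_def diff_add_eq_0_iff)
  finally show ?thesis .
qed

section \<open>Classification of structures up to equivalence by their connections\<close>

lemma transported_structure_mem:
  assumes iso: "mutually_inverse_linear \<phi> \<psi>" and br: "bilinear br"
    and \<gamma>: "\<gamma> \<in> flat_torsion_free_connections br"
  shows "transported_structure \<phi> \<psi> \<gamma> \<in> totally_real_structures br"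
proof -
  have \<gamma>': "bilinear \<gamma>" "flat br \<gamma>" "torsion_free br \<gamma>"
    using \<gamma> by (auto simp: flat_torsion_free_connections_def connection_def)
  have inv: "linear \<phi>" "linear \<psi>" "\<And>x. \<psi> (\<phi> x) = x"
    using iso by (auto simp: mutually_inverse_linear_def)
  show ?thesis
    \<comment> \<open>Pulling the transported representation back along \<open>\<phi>\<close>
      returns \<open>\<gamma>\<close>, by \<open>inv(3)\<close>, so the torsion in the integrability
      criterion is that of \<open>\<gamma>\<close> itself.\<close>
    using \<gamma>' by (simp add: transported_structure_def totally_real_structures_def
        lie_representation_transport_iff[OF iso] complex_structure_swap[OF iso] totally_real_swap[OF iso]
        integrable_swap_iff[OF iso br bilinear_transport[OF _ inv(1,2)]] inv(3))
qed

text \<open>The two equivalences are read in the other direction: with \<open>\<phi>\<close> taken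
  from J, pulling \<open>\<rho>\<close> back to g gives the connection. Statements about arbitrary
  structures thereby become statements about \<open>\<phi>\<close>, \<open>\<psi>\<close> and
  \<open>\<gamma>\<close>.\<close>

lemma totally_real_structure_cases:
  assumes br: "bilinear br" and S: "S \<in> totally_real_structures br"
  obtains \<phi> \<psi> \<gamma> where "mutually_inverse_linear \<phi> \<psi>" "\<gamma> \<in> flat_torsion_free_connections br"
    "S = transported_structure \<phi> \<psi> \<gamma>"
proof -
  obtain \<rho> J where SJ: "S = (\<rho>, J)" and rep: "lie_representation br \<rho>"
    and J: "complex_structure J" "totally_real J"
    and int: "integrable_structure (semidirect_bracket br \<rho>) J"
    using S by (auto simp: totally_real_structures_def)
  obtain \<phi> \<psi> where iso: "mutually_inverse_linear \<phi> \<psi>" and J_eq: "J = swap_structure \<phi> \<psi>"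
    using totally_real_imp_swap[OF J] .
  have inv: "linear \<phi>" "linear \<psi>" "\<And>u. \<phi> (\<psi> u) = u"
    using iso by (auto simp: mutually_inverse_linear_def)
  let ?\<gamma> = "\<lambda>x y. \<psi> (\<rho> x (\<phi> y))"
  have \<rho>: "bilinear \<rho>"
    using rep by (simp add: lie_representation_def)
  have \<gamma>: "bilinear ?\<gamma>"
    using bilinear_transport[OF \<rho> inv(2,1)] .
  have \<rho>_eq: "\<rho> = (\<lambda>x u. \<phi> (?\<gamma> x (\<psi> u)))"
    by (simp add: inv(3))
  have "flat br ?\<gamma>"
    using lie_representation_transport_iff[OF iso \<gamma>] rep \<rho>_eq by simp
  moreover have "torsion_free br ?\<gamma>"
    using int integrable_swap_iff[OF iso br \<rho>] by (simp add: J_eq)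
  ultimately have "?\<gamma> \<in> flat_torsion_free_connections br"
    using \<gamma> by (simp add: flat_torsion_free_connections_def connection_def)
  moreover have "S = transported_structure \<phi> \<psi> ?\<gamma>"
    using \<rho>_eq by (simp add: SJ J_eq transported_structure_def)
  ultimately show ?thesis
    using that iso by blast
qed

lemma connection_of_structure_mem:
  assumes "bilinear br" "S \<in> totally_real_structures br"
  shows "connection_of_structure S \<in> flat_torsion_free_connections br"
  using totally_real_structure_cases[OF assms] connection_of_transported_structure by metis

text \<open>An equivalence is fixed on g, and commuting with J then forces it to be
  \<open>\<phi>' \<circ> \<psi>\<close> on V. The only remaining question is whether this one map
  respects brackets, and the mixed brackets of g with V compare \<open>\<gamma>\<close> with
  \<open>\<gamma>'\<close>.\<close>

lemma sd_equivalent_transported_iff: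
  fixes \<phi> :: "'g::real_vector \<Rightarrow> 'v::real_vector" and \<phi>' :: "'g \<Rightarrow> 'w::real_vector"
  assumes iso: "mutually_inverse_linear \<phi> \<psi>" and iso': "mutually_inverse_linear \<phi>' \<psi>'"
    and br: "bilinear br" and \<gamma>: "bilinear \<gamma>" and \<gamma>': "bilinear \<gamma>'"
  shows "sd_equivalent br (transported_structure \<phi> \<psi> \<gamma>) (transported_structure \<phi>' \<psi>' \<gamma>') \<longleftrightarrow> \<gamma> = \<gamma>'"
proof
  have lin: "linear \<phi>" "linear \<psi>" and inv: "\<And>x. \<psi> (\<phi> x) = x" "\<And>u. \<phi> (\<psi> u) = u"
    using iso by (auto simp: mutually_inverse_linear_def)
  have lin': "linear \<phi>'" "linear \<psi>'" and inv': "\<And>x. \<psi>' (\<phi>' x) = x" "\<And>u. \<phi>' (\<psi>' u) = u"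
    using iso' by (auto simp: mutually_inverse_linear_def)
  note zero = linear_0[OF lin(1)] linear_0[OF lin(2)] linear_0[OF lin'(1)] linear_0[OF lin'(2)]
    bilinear_rzero[OF br] bilinear_lzero[OF \<gamma>] bilinear_rzero[OF \<gamma>] bilinear_lzero[OF \<gamma>'] bilinear_rzero[OF \<gamma>']
  show "\<gamma> = \<gamma>'"
    if equivalent: "sd_equivalent br (transported_structure \<phi> \<psi> \<gamma>) (transported_structure \<phi>' \<psi>' \<gamma>')"
  proof (intro ext)
    fix x y
    obtain F :: "'g \<times> 'v \<Rightarrow> 'g \<times> 'w" where
      hom: "\<And>p q. F (semidirect_bracket br (\<lambda>x u. \<phi> (\<gamma> x (\<psi> u))) p q)
        = semidirect_bracket br (\<lambda>x u. \<phi>' (\<gamma>' x (\<psi>' u))) (F p) (F q)"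
      and hol: "\<And>p. F (swap_structure \<phi> \<psi> p) = swap_structure \<phi>' \<psi>' (F p)"
      and F_g: "\<And>x. F (x, 0) = (x, 0)"
      using equivalent by (auto simp: sd_equivalent_def transported_structure_def)
    \<comment> \<open>Here \<open>(0, \<phi> z)\<close> is J of \<open>(z, 0)\<close>, on which F is
      known.\<close>
    have F_V: "F (0, \<phi> z) = (0, \<phi>' z)" for z
      using hol[of "(z, 0)"] by (simp add: F_g swap_structure_def zero)
    \<comment> \<open>Both sides are F of the bracket of x in g with \<open>\<phi> y\<close> in V,
      the left one by \<open>F_V\<close> and the right one by the homomorphism property.\<close>
    have "(0, \<phi>' (\<gamma> x y)) = (0, \<phi>' (\<gamma>' x y))"
      using hom[of "(x, 0)" "(0, \<phi> y)"]
      by (simp add: semidirect_bracket_def F_g F_V zero inv inv')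
    then show "\<gamma> x y = \<gamma>' x y"
      by (metis inv'(1) prod.inject)
  qed
  \<comment> \<open>The only possible equivalence, by the formula for F on V found above.\<close>
  let ?F = "\<lambda>(x, u). (x, \<phi>' (\<psi> u))" and ?G = "\<lambda>(x, w). (x, \<phi> (\<psi>' w))"
  have "linear ?F"
    using lin(2) lin'(1) by (auto simp: linear_iff)
  moreover have GF: "?G (?F p) = p" and FG: "?F (?G q) = q" for p :: "'g \<times> 'v" and q :: "'g \<times> 'w"
    by (auto simp: inv inv' split: prod.split)
  moreover from this have "bij ?F"
    by (intro o_bij[of ?G]) (auto simp: fun_eq_iff)
  moreover have "?F ` V_part = V_part"
  proof
    show "?F ` V_part \<subseteq> V_part"
      by auto
    have "(0, w) = ?F (0, \<phi> (\<psi>' w))" for w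
      by (simp add: inv inv')
    then show "V_part \<subseteq> ?F ` V_part"
      by blast
  qed
  moreover assume "\<gamma> = \<gamma>'"
  ultimately show "sd_equivalent br (transported_structure \<phi> \<psi> \<gamma>) (transported_structure \<phi>' \<psi>' \<gamma>')"
    unfolding sd_equivalent_def transported_structure_def prod.case
    by (intro exI[of _ ?F] conjI) (assumption | auto simp: semidirect_bracket_def swap_structure_def
        zero inv inv' linear_diff[OF lin(2)] linear_diff[OF lin'(1)])+
qed

text \<open>The connection is a complete invariant, even across different spaces V and W: both
  structures are put in normal form, where it is \<open>\<gamma>\<close> and
  \<open>\<gamma>'\<close> respectively.\<close>

lemma sd_equivalent_iff:
  fixes S :: "('g::real_vector, 'v::real_vector) sd_structure"
    and S' :: "('g, 'w::real_vector) sd_structure"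
  assumes br: "bilinear br" and S: "S \<in> totally_real_structures br" and S': "S' \<in> totally_real_structures br"
  shows "sd_equivalent br S S' \<longleftrightarrow> connection_of_structure S = connection_of_structure S'"
proof -
  obtain \<phi> \<psi> \<gamma> where 1: "mutually_inverse_linear \<phi> \<psi>" "\<gamma> \<in> flat_torsion_free_connections br"
    "S = transported_structure \<phi> \<psi> \<gamma>"
    using totally_real_structure_cases[OF br S] .
  obtain \<phi>' \<psi>' \<gamma>' where 2: "mutually_inverse_linear \<phi>' \<psi>'" "\<gamma>' \<in> flat_torsion_free_connections br"
    "S' = transported_structure \<phi>' \<psi>' \<gamma>'"
    using totally_real_structure_cases[OF br S'] .
  have "bilinear \<gamma>" "bilinear \<gamma>'"
    using 1(2) 2(2) by (auto simp: flat_torsion_free_connections_def connection_def)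
  from sd_equivalent_transported_iff[OF 1(1) 2(1) br this] show ?thesis
    by (simp add: 1(3) 2(3) connection_of_transported_structure[OF 1(1)]
        connection_of_transported_structure[OF 2(1)])
qed

section \<open>Isomorphisms from equal dimensions, and fibres of a surjection\<close>

lemma finite_dim_basis:
  assumes "finite_dim TYPE('a::real_vector)"
  obtains B :: "'a::real_vector set" where "finite B" "independent B" "span B = UNIV" "card B = dim (UNIV :: 'a set)"
proof -
  obtain A :: "'a set" where A: "finite A" "span A = UNIV"
    using assms by (auto simp: finite_dim_def)
  obtain B :: "'a set" where B: "independent B" "UNIV \<subseteq> span B" "card B = dim (UNIV :: 'a set)"
    by (rule basis_exists[of "UNIV :: 'a set"])
  have "finite B"
    using independent_span_bound[OF A(1) B(1)] A(2) by simp
  with B that show ?thesis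
    by blast
qed

text \<open>A bijection between bases and its inverse are extended linearly; both composites fix a
  basis. This supplies the \<open>\<phi>\<close> that realizes connections on a prescribed
  V.\<close>

lemma mutually_inverse_linear_of_dim_eq:
  assumes "finite_dim TYPE('a::real_vector)" "finite_dim TYPE('b::real_vector)"
    and "dim (UNIV :: 'a::real_vector set) = dim (UNIV :: 'b::real_vector set)"
  obtains \<phi> :: "'a::real_vector \<Rightarrow> 'b::real_vector" and \<psi> where "mutually_inverse_linear \<phi> \<psi>"
proof -
  obtain A :: "'a set" where A: "finite A" "independent A" "span A = UNIV" "card A = dim (UNIV :: 'a set)"
    using finite_dim_basis[OF assms(1)] .
  obtain B :: "'b set" where B: "finite B" "independent B" "span B = UNIV" "card B = dim (UNIV :: 'b set)"
    using finite_dim_basis[OF assms(2)] .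
  obtain f where f: "bij_betw f A B"
    using finite_same_card_bij A(1,4) B(1,4) assms(3) by metis
  obtain \<phi> where \<phi>: "linear \<phi>" "\<forall>a\<in>A. \<phi> a = f a"
    using linear_independent_extend[OF A(2)] by blast
  obtain \<psi> where \<psi>: "linear \<psi>" "\<forall>b\<in>B. \<psi> b = inv_into A f b"
    using linear_independent_extend[OF B(2)] by blast
  have "\<psi> (\<phi> x) = id x" for x
  proof (rule linear_eq_on_span[where f = "\<lambda>x. \<psi> (\<phi> x)" and g = id and B = A])
    show "linear (\<lambda>x. \<psi> (\<phi> x))"
      using linear_compose[OF \<phi>(1) \<psi>(1)] by (simp add: o_def)
    show "\<psi> (\<phi> a) = id a" if "a \<in> A" for a
      using that f \<phi>(2) \<psi>(2) by (simp add: bij_betwE bij_betw_inv_into_left)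
  qed (simp_all add: A(3) linear_id)
  moreover have "\<phi> (\<psi> u) = id u" for u
  proof (rule linear_eq_on_span[where f = "\<lambda>u. \<phi> (\<psi> u)" and g = id and B = B])
    show "linear (\<lambda>u. \<phi> (\<psi> u))"
      using linear_compose[OF \<psi>(1) \<phi>(1)] by (simp add: o_def)
    show "\<phi> (\<psi> b) = id b" if "b \<in> B" for b
      using that f \<phi>(2) \<psi>(2)
      by (metis bij_betwE bij_betw_inv_into bij_betw_inv_into_right id_apply)
  qed (simp_all add: B(3) linear_id)
  ultimately show ?thesis
    using that[of \<phi> \<psi>] \<phi>(1) \<psi>(1) by (simp add: mutually_inverse_linear_def)
qed

text \<open>The classes of the kernel of f are its fibres. Surjectivity onto B makes every fibre
  nonempty, so a fibre determines its point.\<close>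

lemma bij_betw_fibres_quotient:
  assumes f: "f ` A = B"
  shows "bij_betw (\<lambda>b. {a \<in> A. f a = b}) B (A // {(a, a'). a \<in> A \<and> a' \<in> A \<and> f a = f a'})"
  unfolding bij_betw_def
proof
  show "inj_on (\<lambda>b. {a \<in> A. f a = b}) B"
    using f by (auto simp: inj_on_def)
  have "{(a, a'). a \<in> A \<and> a' \<in> A \<and> f a = f a'} `` {a} = {a' \<in> A. f a' = f a}" if "a \<in> A" for a
    using that by auto
  then show "(\<lambda>b. {a \<in> A. f a = b}) ` B = A // {(a, a'). a \<in> A \<and> a' \<in> A \<and> f a = f a'}"
    unfolding f[symmetric] quotient_def image_image by auto
qed

theorem proposition3p2:
  fixes br :: "'g::real_vector \<Rightarrow> 'g \<Rightarrow> 'g"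
  assumes "lie_algebra br"
    and "finite_dim TYPE('v::real_vector)"
    and "finite_dim TYPE('w::real_vector)"
  shows
    \<comment> \<open>the two constructions are well defined\<close>
    "(\<forall>\<gamma> \<in> flat_torsion_free_connections br.
        structure_of_connection \<gamma> \<in> totally_real_structures br) \<and>
     (\<forall>S \<in> (totally_real_structures br :: ('g, 'v) sd_structure set).
        connection_of_structure S \<in> flat_torsion_free_connections br) \<and>
     \<comment> \<open>they are mutually inverse up to equivalence, for every vector space V\<close>
     (\<forall>\<gamma> \<in> flat_torsion_free_connections br.
        connection_of_structure (structure_of_connection \<gamma>) = \<gamma>) \<and>
     (\<forall>S \<in> (totally_real_structures br :: ('g, 'v) sd_structure set).
        sd_equivalent br S (structure_of_connection (connection_of_structure S))) \<and>
     \<comment> \<open>structures on any two vector spaces V, W are equivalent iff the connections agree\<close>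
     (\<forall>S \<in> (totally_real_structures br :: ('g, 'v) sd_structure set).
      \<forall>S' \<in> (totally_real_structures br :: ('g, 'w) sd_structure set).
        sd_equivalent br S S' \<longleftrightarrow> connection_of_structure S = connection_of_structure S') \<and>
     \<comment> \<open>bijection with equivalence classes, for every V of the dimension of g\<close>
     equiv (totally_real_structures br)
       (sd_equivalence br :: (('g, 'v) sd_structure \<times> ('g, 'v) sd_structure) set) \<and>
     (dim (UNIV :: 'v set) = dim (UNIV :: 'g set) \<longrightarrow>
        bij_betw
          (\<lambda>\<gamma>. {S \<in> totally_real_structures br. sd_equivalent br S (structure_of_connection \<gamma>)})
          (flat_torsion_free_connections br)
          (totally_real_structures br //
            (sd_equivalence br :: (('g, 'v) sd_structure \<times> ('g, 'v) sd_structure) set)))"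
proof (intro conjI ballI impI)
  have br: "bilinear br" and fin: "finite_dim TYPE('g)"
    using assms(1) by (auto simp: lie_algebra_def)
  show struct: "structure_of_connection \<gamma> \<in> totally_real_structures br"
    if "\<gamma> \<in> flat_torsion_free_connections br" for \<gamma>
    using that transported_structure_mem[OF mutually_inverse_linear_id br]
    by (simp add: structure_of_connection_eq_transported)
  show conn: "connection_of_structure S \<in> flat_torsion_free_connections br"
    if "S \<in> totally_real_structures br" for S :: "('g, 'v) sd_structure"
    using connection_of_structure_mem[OF br that] .
  have conn_struct: "connection_of_structure (structure_of_connection \<gamma>) = \<gamma>" for \<gamma> :: "'g \<Rightarrow> 'g \<Rightarrow> 'g"
    unfolding structure_of_connection_eq_transported
    by (rule connection_of_transported_structure[OF mutually_inverse_linear_id])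
  then show "connection_of_structure (structure_of_connection \<gamma>) = \<gamma>" for \<gamma> :: "'g \<Rightarrow> 'g \<Rightarrow> 'g" .
  show "sd_equivalent br S (structure_of_connection (connection_of_structure S))"
    if "S \<in> totally_real_structures br" for S :: "('g, 'v) sd_structure"
    \<comment> \<open>By the invariant it suffices that both structures have the same connection,
      which is \<open>conn_struct\<close>.\<close>
    by (simp add: sd_equivalent_iff[OF br that struct[OF conn[OF that]]] conn_struct)
  show "sd_equivalent br S S' \<longleftrightarrow> connection_of_structure S = connection_of_structure S'"
    if "S \<in> totally_real_structures br" "S' \<in> totally_real_structures br"
    for S :: "('g, 'v) sd_structure" and S' :: "('g, 'w) sd_structure"
    using sd_equivalent_iff[OF br that] .
  \<comment> \<open>Equivalence becomes the kernel of \<open>connection_of_structure\<close>: this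
    yields the equivalence relation at once and the form required by
    \<open>bij_betw_fibres_quotient\<close>.\<close>
  have rel: "(sd_equivalence br :: (('g, 'v) sd_structure \<times> ('g, 'v) sd_structure) set) =
    {(S, S'). S \<in> totally_real_structures br \<and> S' \<in> totally_real_structures br \<and>
      connection_of_structure S = connection_of_structure S'}"
    by (auto simp: sd_equivalence_def sd_equivalent_iff[OF br])
  show "equiv (totally_real_structures br)
    (sd_equivalence br :: (('g, 'v) sd_structure \<times> ('g, 'v) sd_structure) set)"
    unfolding rel by (rule equivI) (auto simp: refl_on_def sym_def trans_def)
  assume "dim (UNIV :: 'v set) = dim (UNIV :: 'g set)"
  then obtain \<phi> :: "'g \<Rightarrow> 'v" and \<psi> where iso: "mutually_inverse_linear \<phi> \<psi>"
    using mutually_inverse_linear_of_dim_eq[OF fin assms(2)] by metis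
  \<comment> \<open>The equal dimensions enter here: \<open>structure_of_connection\<close> lives on
    g itself, so a preimage on V is obtained by transporting \<open>\<gamma>\<close> along
    \<open>\<phi>\<close>.\<close>
  have onto: "connection_of_structure ` (totally_real_structures br :: ('g, 'v) sd_structure set) =
    flat_torsion_free_connections br"
  proof
    show "flat_torsion_free_connections br \<subseteq>
      connection_of_structure ` (totally_real_structures br :: ('g, 'v) sd_structure set)"
      using transported_structure_mem[OF iso br] connection_of_transported_structure[OF iso]
      by (metis image_eqI subsetI)
  qed (use conn in auto)
  \<comment> \<open>The structures on V are compared with one on g. The invariant turns this
    comparison into membership in the fibre over \<open>\<gamma>\<close>.\<close>
  have fibre: "{S \<in> totally_real_structures br. sd_equivalent br S (structure_of_connection \<gamma>)} =
    {S \<in> totally_real_structures br. connection_of_structure (S :: ('g, 'v) sd_structure) = \<gamma>}"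
    if "\<gamma> \<in> flat_torsion_free_connections br" for \<gamma>
    using sd_equivalent_iff[OF br _ struct[OF that]] by (auto simp: conn_struct)
  show "bij_betw
      (\<lambda>\<gamma>. {S \<in> totally_real_structures br. sd_equivalent br S (structure_of_connection \<gamma>)})
      (flat_torsion_free_connections br)
      (totally_real_structures br //
        (sd_equivalence br :: (('g, 'v) sd_structure \<times> ('g, 'v) sd_structure) set))"
    using bij_betw_fibres_quotient[OF onto]
    unfolding rel by (simp add: fibre cong: bij_betw_cong)
qed

end
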